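(* A triangle-free graph $G$ is minimally nonperfectly divisible if and only if $G$ is $4$-critical, i.e., $\chi(G)=4$ and $\chi(G-v)<4$ for every vertex $v$ of $G$.
   Context: Graphs are finite and simple. A perfect division of $G$ is a partition $(A,B)$ of $V(G)$ such that $G[A]$ is perfect and $\omega(G[B])<\omega(G)$. $G$ is perfectly divisible if every nonempty induced subgraph has a perfect division; $G$ is minimally nonperfectly divisible if $G$ is not perfectly divisible but every proper induced subgraph is. *)

theory Defs
  imports "Graph_Theory.Kuratowski"
begin

text \<open>
  A finite simple graph is an instance of the locale \<^locale>\<open>graph\<close>: a finite symmetric digraph
  without loops and without parallel arcs, an undirected edge being a pair of opposite arcs.
  The graph without vertices is allowed.
\<close>

definition triangle_free :: "('a,'b) pre_digraph \<Rightarrow> bool" where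
  "triangle_free G \<longleftrightarrow> \<not> (\<exists>H. subgraph H G \<and> complete_digraph 3 H)"

definition clique :: "('a,'b) pre_digraph \<Rightarrow> 'a set \<Rightarrow> bool" where
  "clique G S \<longleftrightarrow> S \<subseteq> verts G \<and> (\<forall>u\<in>S. \<forall>v\<in>S. u \<noteq> v \<longrightarrow> u \<rightarrow>\<^bsub>G\<^esub> v)"

text \<open>The empty set is a clique, so the graph without vertices has clique number 0.\<close>

definition clique_number :: "('a,'b) pre_digraph \<Rightarrow> nat" where
  "clique_number G = Max (card ` {S. clique G S})"

definition proper_coloring :: "('a,'b) pre_digraph \<Rightarrow> nat \<Rightarrow> ('a \<Rightarrow> nat) \<Rightarrow> bool" where
  "proper_coloring G k c \<longleftrightarrow>
     (\<forall>v\<in>verts G. c v < k) \<and> (\<forall>u v. u \<rightarrow>\<^bsub>G\<^esub> v \<longrightarrow> c u \<noteq> c v)"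

definition chromatic_number :: "('a,'b) pre_digraph \<Rightarrow> nat" where
  "chromatic_number G = (LEAST k. \<exists>c. proper_coloring G k c)"

definition perfect_graph :: "('a,'b) pre_digraph \<Rightarrow> bool" where
  "perfect_graph G \<longleftrightarrow>
     (\<forall>H. induced_subgraph H G \<longrightarrow> chromatic_number H = clique_number H)"

text \<open>Either part of a perfect division may be empty.\<close>

definition perfect_division :: "('a,'b) pre_digraph \<Rightarrow> 'a set \<Rightarrow> 'a set \<Rightarrow> bool" where
  "perfect_division G A B \<longleftrightarrow>
     A \<union> B = verts G \<and> A \<inter> B = {} \<and>
     perfect_graph (G \<restriction> A) \<and> clique_number (G \<restriction> B) < clique_number G"

definition perfectly_divisible :: "('a,'b) pre_digraph \<Rightarrow> bool" where
  "perfectly_divisible G \<longleftrightarrow>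
     (\<forall>H. induced_subgraph H G \<and> verts H \<noteq> {} \<longrightarrow> (\<exists>A B. perfect_division H A B))"

definition minimally_nonperfectly_divisible :: "('a,'b) pre_digraph \<Rightarrow> bool" where
  "minimally_nonperfectly_divisible G \<longleftrightarrow>
     \<not> perfectly_divisible G \<and>
     (\<forall>H. induced_subgraph H G \<and> verts H \<noteq> verts G \<longrightarrow> perfectly_divisible H)"

definition vertex_critical :: "nat \<Rightarrow> ('a,'b) pre_digraph \<Rightarrow> bool" where
  "vertex_critical k G \<longleftrightarrow>
     chromatic_number G = k \<and>
     (\<forall>v\<in>verts G. chromatic_number (pre_digraph.del_vert G v) < k)"

end

theory Submission
  imports Defs
begin

text \<open>
  In a triangle-free graph a perfect part is bipartite, and a part of clique number at most 1 is
  independent. So a triangle-free graph is perfectly divisible iff it is 3-colourable, and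
  minimality becomes criticality because removing a vertex lowers the chromatic number by at
  most 1.
\<close>

section \<open>Induced subgraphs\<close>

lemma adj_induce_iff: "u \<rightarrow>\<^bsub>G \<restriction> S\<^esub> v \<longleftrightarrow> u \<rightarrow>\<^bsub>G\<^esub> v \<and> u \<in> S \<and> v \<in> S"
  by (auto simp: arcs_ends_conv image_iff)

lemma induce_induce:
  assumes "S \<subseteq> T"
  shows "(G \<restriction> T) \<restriction> S = G \<restriction> S"
  using assms by (auto simp: induce_subgraph_def)

lemma (in wf_digraph) induce_verts: "G \<restriction> verts G = G"
  by (intro pre_digraph.equality) auto

lemma (in wf_digraph) del_vert_eq_induce: "del_vert v = G \<restriction> (verts G - {v})"
  by (auto simp: induce_subgraph_def del_vert_def)

text \<open>Compatibility forces equal \<open>tail\<close> and \<open>head\<close> maps, and the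
  arcs are determined by the vertices, so an induced subgraph is fixed by its vertex set.
  Quantifiers over \<open>H\<close> thus become quantifiers over vertex sets.\<close>

lemma (in wf_digraph) induced_subgraph_iff:
  "induced_subgraph H G \<longleftrightarrow> (\<exists>S \<subseteq> verts G. H = G \<restriction> S)"
proof
  assume H: "induced_subgraph H G"
  then have "verts H \<subseteq> verts G"
    by (auto simp: induced_subgraph_def subgraph_def)
  moreover have "H = G \<restriction> verts H"
    using H by (intro pre_digraph.equality)
      (auto simp: induced_subgraph_def subgraph_def compatible_def)
  ultimately show "\<exists>S \<subseteq> verts G. H = G \<restriction> S" by blast
qed auto

lemma (in graph) graph_induce:
  assumes "S \<subseteq> verts G"
  shows "graph (G \<restriction> S)"
proof -
  interpret H: wf_digraph "G \<restriction> S"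
    using wellformed_induce_subgraph .
  have "finite S" using assms finite_verts by (rule finite_subset)
  then have "digraph (G \<restriction> S)"
    by unfold_locales (auto simp: no_loops no_multi_arcs)
  moreover have "symmetric (G \<restriction> S)"
    using sym_arcs by (auto simp: symmetric_def sym_def adj_induce_iff)
  ultimately show ?thesis by (rule digraph.graphI)
qed

section \<open>Clique number\<close>

lemma (in graph) finite_cliques: "finite {S. clique G S}"
  by (rule finite_subset[of _ "Pow (verts G)"]) (auto simp: clique_def)

lemma (in graph) card_clique_le:
  assumes "clique G S"
  shows "card S \<le> clique_number G"
  unfolding clique_number_def using finite_cliques assms by (intro Max_ge) auto

lemma (in graph) clique_number_leI:
  assumes "\<And>S. clique G S \<Longrightarrow> card S \<le> k"
  shows "clique_number G \<le> k"
proof -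
  have "clique G {}" by (simp add: clique_def)
  then show ?thesis
    unfolding clique_number_def using finite_cliques assms by (subst Max_le_iff) auto
qed

lemma clique_induceD: "T \<subseteq> verts G \<Longrightarrow> clique (G \<restriction> T) S \<Longrightarrow> clique G S"
  by (auto simp: clique_def adj_induce_iff)

lemma (in graph) clique_number_induce_le:
  assumes "T \<subseteq> verts G"
  shows "clique_number (G \<restriction> T) \<le> clique_number G"
  using assms graph_induce
  by (intro graph.clique_number_leI) (auto intro: card_clique_le dest: clique_induceD)

lemma (in graph) clique_number_pos:
  assumes "verts G \<noteq> {}"
  shows "0 < clique_number G"
proof -
  obtain v where "v \<in> verts G" using assms by blast
  then have "clique G {v}" by (auto simp: clique_def)
  from card_clique_le[OF this] show ?thesis by simp
qed

lemma (in graph) clique_number_adj: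
  assumes "u \<rightarrow>\<^bsub>G\<^esub> v"
  shows "2 \<le> clique_number G"
proof -
  have "u \<noteq> v" using assms adj_not_same by auto
  have "v \<rightarrow>\<^bsub>G\<^esub> u" using assms by (rule arcs_ends_symmetric[OF sym_arcs])
  then have "clique G {u, v}" using assms adj_in_verts by (auto simp: clique_def)
  from card_clique_le[OF this] \<open>u \<noteq> v\<close> show ?thesis by simp
qed

text \<open>Any three vertices of a larger clique induce a complete digraph on three
  vertices.\<close>

lemma (in graph) triangle_free_clique_number_le:
  assumes "triangle_free G"
  shows "clique_number G \<le> 2"
proof (rule clique_number_leI, rule ccontr)
  fix S assume S: "clique G S" and "\<not> card S \<le> 2"
  then have "3 \<le> card S" by simp
  then obtain T where T: "T \<subseteq> S" "card T = 3" by (metis obtain_subset_with_card_n)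
  have "T \<subseteq> verts G" using T S by (auto simp: clique_def)
  then have "graph (G \<restriction> T)" and "subgraph (G \<restriction> T) G"
    using graph_induce induced_induce by auto
  moreover have "arcs_ends (G \<restriction> T) = {(u, v). (u, v) \<in> T \<times> T \<and> u \<noteq> v}"
    using T(1) S adj_not_same by (fastforce simp: clique_def adj_induce_iff)
  ultimately have "complete_digraph 3 (G \<restriction> T)"
    using T(2) unfolding complete_digraph_def induce_subgraph_verts by blast
  then show False
    using assms \<open>subgraph (G \<restriction> T) G\<close> unfolding triangle_free_def by blast
qed

section \<open>Chromatic number\<close>

lemma proper_coloring_mono: "proper_coloring G k c \<Longrightarrow> k \<le> l \<Longrightarrow> proper_coloring G l c"
  by (force simp: proper_coloring_def)

lemma proper_coloring_induce:
  "proper_coloring G k c \<Longrightarrow> S \<subseteq> verts G \<Longrightarrow> proper_coloring (G \<restriction> S) k c"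
  by (auto simp: proper_coloring_def adj_induce_iff)

text \<open>An injective numbering of the vertices is proper because there are no loops. This makes
  the \<open>LEAST\<close> in \<open>chromatic_number\<close> meaningful.\<close>

lemma (in graph) ex_proper_coloring: "\<exists>k c. proper_coloring G k c"
proof -
  obtain c where c: "bij_betw c (verts G) {0..<card (verts G)}"
    using finite_verts ex_bij_betw_finite_nat by blast
  have "proper_coloring G (card (verts G)) c"
    unfolding proper_coloring_def
  proof (intro conjI allI ballI impI)
    show "c v < card (verts G)" if "v \<in> verts G" for v
      using bij_betwE[OF c] that by auto
    show "c u \<noteq> c v" if "u \<rightarrow>\<^bsub>G\<^esub> v" for u v
      using that adj_not_same adj_in_verts[OF that] bij_betw_imp_inj_on[OF c]
      by (auto dest: inj_onD)
  qed
  then show ?thesis by blast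
qed

text \<open>The minimum is attained, and a colouring stays proper when the palette grows. From here
  on bounds on \<chi> are proved by exhibiting colourings.\<close>

lemma (in graph) chromatic_number_le_iff:
  "chromatic_number G \<le> k \<longleftrightarrow> (\<exists>c. proper_coloring G k c)"
proof
  assume "chromatic_number G \<le> k"
  moreover have "\<exists>c. proper_coloring G (chromatic_number G) c"
    unfolding chromatic_number_def using ex_proper_coloring by (rule LeastI_ex)
  ultimately show "\<exists>c. proper_coloring G k c" using proper_coloring_mono by blast
next
  assume "\<exists>c. proper_coloring G k c"
  then show "chromatic_number G \<le> k" unfolding chromatic_number_def by (rule Least_le)
qed

lemma (in graph) chromatic_number_induce_le:
  assumes "S \<subseteq> verts G"
  shows "chromatic_number (G \<restriction> S) \<le> chromatic_number G"
proof -
  interpret H: graph "G \<restriction> S" using assms by (rule graph_induce)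
  obtain c where "proper_coloring G (chromatic_number G) c"
    using chromatic_number_le_iff[of "chromatic_number G"] by auto
  then show ?thesis
    using assms by (auto simp: H.chromatic_number_le_iff intro: proper_coloring_induce)
qed

text \<open>Colour the two parts optimally with disjoint palettes.\<close>

lemma (in graph) chromatic_number_union_le:
  assumes "A \<union> B = verts G"
  shows "chromatic_number G \<le> chromatic_number (G \<restriction> A) + chromatic_number (G \<restriction> B)"
proof -
  interpret A: graph "G \<restriction> A" using assms by (intro graph_induce) auto
  interpret B: graph "G \<restriction> B" using assms by (intro graph_induce) auto
  let ?k = "chromatic_number (G \<restriction> A)" and ?l = "chromatic_number (G \<restriction> B)"
  obtain a where a: "proper_coloring (G \<restriction> A) ?k a"
    using A.chromatic_number_le_iff[of ?k] by auto
  obtain b where b: "proper_coloring (G \<restriction> B) ?l b"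
    using B.chromatic_number_le_iff[of ?l] by auto
  \<comment> \<open>Colours from \<open>b\<close> are shifted by \<open>?k\<close>, above all values
    of \<open>a\<close> on \<open>A\<close>, so an edge between the parts is never monochromatic. A
    vertex in both sets takes its colour from \<open>a\<close>.\<close>
  let ?c = "\<lambda>v. if v \<in> A then a v else ?k + b v"
  have "proper_coloring G (?k + ?l) ?c"
    unfolding proper_coloring_def
  proof (intro conjI allI ballI impI)
    show "?c v < ?k + ?l" if "v \<in> verts G" for v
      using that assms a b by (auto simp: proper_coloring_def)
    show "?c u \<noteq> ?c v" if uv: "u \<rightarrow>\<^bsub>G\<^esub> v" for u v
    proof -
      have lt: "a w < ?k" if "w \<in> A" for w
        using a that by (auto simp: proper_coloring_def)
      have "u \<in> A \<union> B" "v \<in> A \<union> B" using adj_in_verts[OF uv] assms by auto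
      then show ?thesis
        using uv a b lt[of u] lt[of v] by (auto simp: proper_coloring_def adj_induce_iff)
    qed
  qed
  then show ?thesis using chromatic_number_le_iff by blast
qed

text \<open>A proper colouring is injective on every clique.\<close>

lemma (in graph) clique_number_le_chromatic_number: "clique_number G \<le> chromatic_number G"
proof (rule clique_number_leI)
  fix S assume S: "clique G S"
  obtain c where c: "proper_coloring G (chromatic_number G) c"
    using chromatic_number_le_iff[of "chromatic_number G"] by auto
  have "card S \<le> card {..<chromatic_number G}"
  proof (rule card_inj_on_le)
    show "inj_on c S"
      using S c by (intro inj_onI) (metis clique_def proper_coloring_def)
    show "c ` S \<subseteq> {..<chromatic_number G}"
      using S c by (auto simp: clique_def proper_coloring_def)
  qed simp
  then show "card S \<le> chromatic_number G" by simp
qed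

text \<open>Both conditions express that there are no edges: an edge is a clique of size 2 and needs
  two colours.\<close>

lemma (in graph) chromatic_number_le_1_iff: "chromatic_number G \<le> 1 \<longleftrightarrow> clique_number G \<le> 1"
proof
  assume "clique_number G \<le> 1"
  then have "proper_coloring G 1 (\<lambda>_. 0)"
    using clique_number_adj by (fastforce simp: proper_coloring_def)
  then show "chromatic_number G \<le> 1" using chromatic_number_le_iff by blast
next
  assume "chromatic_number G \<le> 1"
  then show "clique_number G \<le> 1" using clique_number_le_chromatic_number by simp
qed

text \<open>Since \<omega> \<le> \<chi> \<le> 2, only \<omega> < \<chi> has to be excluded: a vertex
  gives \<omega> \<ge> 1, and \<omega> \<le> 1 forces \<chi> \<le> 1. The graph without vertices has
  both numbers 0.\<close>

lemma (in graph) chromatic_number_eq_clique_number: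
  assumes "chromatic_number G \<le> 2"
  shows "chromatic_number G = clique_number G"
proof (cases "verts G = {}")
  case True
  then have "proper_coloring G 0 (\<lambda>_. 0)"
    using adj_in_verts by (auto simp: proper_coloring_def)
  then have "chromatic_number G = 0" using chromatic_number_le_iff[of 0] by auto
  then show ?thesis using clique_number_le_chromatic_number by simp
next
  case False
  then show ?thesis
    using assms clique_number_le_chromatic_number clique_number_pos chromatic_number_le_1_iff
    by linarith
qed

section \<open>Perfect divisions\<close>

text \<open>The bound on \<chi> passes to every induced subgraph, where it forces \<chi> =
  \<omega>.\<close>

lemma (in graph) perfect_graph_bipartite:
  assumes "chromatic_number G \<le> 2"
  shows "perfect_graph G"
  unfolding perfect_graph_def induced_subgraph_iff
proof (intro allI impI, elim exE conjE)
  fix H S assume "S \<subseteq> verts G" "H = G \<restriction> S"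
  then show "chromatic_number H = clique_number H"
    using assms graph.chromatic_number_eq_clique_number graph_induce chromatic_number_induce_le
    by (metis le_trans)
qed

text \<open>Perfection gives \<chi> = \<omega> \<le> 2 on \<open>A\<close>, and \<open>B\<close> has
  \<omega> \<le> 1, hence is independent; two colours plus one suffice.\<close>

lemma (in graph) chromatic_number_le_3_if_division:
  assumes "perfect_division G A B" and "clique_number G \<le> 2"
  shows "chromatic_number G \<le> 3"
proof -
  have AB: "A \<union> B = verts G" and perf: "perfect_graph (G \<restriction> A)"
    and \<omega>: "clique_number (G \<restriction> B) < clique_number G"
    using assms by (auto simp: perfect_division_def)
  interpret A: graph "G \<restriction> A" using AB by (intro graph_induce) auto
  interpret B: graph "G \<restriction> B" using AB by (intro graph_induce) auto
  have "chromatic_number (G \<restriction> A) = clique_number (G \<restriction> A)"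
    using perf A.induced_subgraph_refl by (auto simp: perfect_graph_def)
  also have "\<dots> \<le> 2"
    using clique_number_induce_le[of A] AB assms(2) by (blast intro: le_trans)
  finally have "chromatic_number (G \<restriction> A) \<le> 2" .
  moreover have "chromatic_number (G \<restriction> B) \<le> 1"
    using \<omega> assms B.chromatic_number_le_1_iff by simp
  ultimately show ?thesis using chromatic_number_union_le[OF AB] by linarith
qed

lemma (in graph) division_if_chromatic_number_le_3:
  assumes "chromatic_number G \<le> 3" and "verts G \<noteq> {}"
  shows "\<exists>A B. perfect_division G A B"
proof (cases "clique_number G \<le> 1")
  \<comment> \<open>Without edges a nonempty \<open>B\<close> would have clique number 1, which is
    not below that of \<open>G\<close>. So all vertices go into the perfect part, and the empty part
    has clique number 0.\<close>
  case True
  have "graph (G \<restriction> {})" using graph_induce by simp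
  then have "clique_number (G \<restriction> {}) \<le> 0"
    by (rule graph.clique_number_leI) (auto simp: clique_def)
  moreover have "perfect_graph G"
    using True chromatic_number_le_1_iff by (intro perfect_graph_bipartite) simp
  ultimately have "perfect_division G (verts G) {}"
    using clique_number_pos[OF assms(2)] by (auto simp: perfect_division_def induce_verts)
  then show ?thesis by blast
next
  case False
  obtain c where c: "proper_coloring G 3 c"
    using assms chromatic_number_le_iff by blast
  \<comment> \<open>With an edge present, \<omega> \<ge> 2: two colour classes form a bipartite,
    hence perfect, part, and the third class is independent with \<omega> \<le> 1.\<close>
  define A where "A = {v \<in> verts G. c v < 2}"
  define B where "B = {v \<in> verts G. c v = 2}"
  interpret A: graph "G \<restriction> A" by (intro graph_induce) (auto simp: A_def)
  interpret B: graph "G \<restriction> B" by (intro graph_induce) (auto simp: B_def)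
  have "proper_coloring (G \<restriction> A) 2 c"
    using c by (auto simp: A_def proper_coloring_def adj_induce_iff)
  then have "perfect_graph (G \<restriction> A)"
    using A.chromatic_number_le_iff by (intro A.perfect_graph_bipartite) blast
  moreover have "proper_coloring (G \<restriction> B) 1 (\<lambda>_. 0)"
    using c by (fastforce simp: B_def proper_coloring_def adj_induce_iff)
  then have "clique_number (G \<restriction> B) \<le> 1"
    using B.chromatic_number_le_iff B.chromatic_number_le_1_iff by blast
  moreover have "c v < 2 \<or> c v = 2" if "v \<in> verts G" for v
    using c that by (force simp: proper_coloring_def)
  then have "A \<union> B = verts G" "A \<inter> B = {}" by (auto simp: A_def B_def)
  ultimately have "perfect_division G A B"
    using False by (auto simp: perfect_division_def)
  then show ?thesis by blast
qed

text \<open>Dividing \<open>G\<close> itself yields a 3-colouring; conversely a 3-colouring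
  restricts to each induced subgraph and divides it. The hypothesis bounds \<omega> because such a
  bound is directly inherited by induced subgraphs.\<close>

lemma (in graph) perfectly_divisible_iff:
  assumes "clique_number G \<le> 2"
  shows "perfectly_divisible G \<longleftrightarrow> chromatic_number G \<le> 3"
proof
  assume pd: "perfectly_divisible G"
  show "chromatic_number G \<le> 3"
  proof (cases "verts G = {}")
    \<comment> \<open>Perfect divisibility gives no division of a graph without vertices, so this
      case is coloured directly.\<close>
    case True
    then have "proper_coloring G 3 (\<lambda>_. 0)"
      using adj_in_verts by (auto simp: proper_coloring_def)
    then show ?thesis using chromatic_number_le_iff by blast
  next
    case False
    then obtain A B where "perfect_division G A B"
      using pd induced_subgraph_refl unfolding perfectly_divisible_def by blast
    then show ?thesis using assms by (rule chromatic_number_le_3_if_division)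
  qed
next
  assume \<chi>: "chromatic_number G \<le> 3"
  show "perfectly_divisible G"
    unfolding perfectly_divisible_def induced_subgraph_iff
  proof (intro allI impI, elim exE conjE)
    fix H S assume "verts H \<noteq> {}" "S \<subseteq> verts G" "H = G \<restriction> S"
    then show "\<exists>A B. perfect_division H A B"
      using \<chi> graph.division_if_chromatic_number_le_3 graph_induce chromatic_number_induce_le
      by (metis le_trans)
  qed
qed

section \<open>Minimality and vertex-criticality\<close>

theorem theorem7:
  fixes G :: "('a, 'b) pre_digraph"
  assumes "graph G" and "triangle_free G"
  shows "minimally_nonperfectly_divisible G \<longleftrightarrow> vertex_critical 4 G"
proof -
  interpret graph G by fact
  have \<omega>: "clique_number G \<le> 2"
    using assms(2) by (rule triangle_free_clique_number_le)
  have pd: "perfectly_divisible (G \<restriction> S) \<longleftrightarrow> chromatic_number (G \<restriction> S) \<le> 3"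
    if "S \<subseteq> verts G" for S
    using that \<omega> clique_number_induce_le
    by (intro graph.perfectly_divisible_iff graph_induce) (auto intro: le_trans)
  \<comment> \<open>Monotonicity of \<chi> inside \<open>del_vert v\<close>: vertex deletions are
    the largest proper induced subgraphs, so testing them tests all.\<close>
  have del: "chromatic_number (G \<restriction> S) \<le> chromatic_number (del_vert v)"
    if "S \<subseteq> verts G - {v}" for S v
  proof -
    have "graph (del_vert v)" unfolding del_vert_eq_induce by (intro graph_induce) auto
    then have "chromatic_number (del_vert v \<restriction> S) \<le> chromatic_number (del_vert v)"
      using that by (intro graph.chromatic_number_induce_le) (auto simp: verts_del_vert)
    then show ?thesis using that by (simp add: del_vert_eq_induce induce_induce)
  qed
  have "minimally_nonperfectly_divisible G \<longleftrightarrow>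
      3 < chromatic_number G \<and> (\<forall>S \<subset> verts G. chromatic_number (G \<restriction> S) \<le> 3)"
  proof -
    have "minimally_nonperfectly_divisible G \<longleftrightarrow>
        \<not> perfectly_divisible G \<and> (\<forall>S \<subset> verts G. perfectly_divisible (G \<restriction> S))"
      unfolding minimally_nonperfectly_divisible_def induced_subgraph_iff psubset_eq
      by (metis induce_subgraph_verts)
    then show ?thesis
      using pd perfectly_divisible_iff[OF \<omega>] by (simp add: not_le psubset_eq)
  qed
  also have "\<dots> \<longleftrightarrow>
      3 < chromatic_number G \<and> (\<forall>v \<in> verts G. chromatic_number (del_vert v) \<le> 3)"
  proof (intro conj_cong refl iffI ballI allI impI)
    fix v assume "\<forall>S \<subset> verts G. chromatic_number (G \<restriction> S) \<le> 3" "v \<in> verts G"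
    then show "chromatic_number (del_vert v) \<le> 3"
      unfolding del_vert_eq_induce by blast
  next
    \<comment> \<open>A proper subset misses some vertex \<open>v\<close>, so it lies inside the
      vertex set of \<open>del_vert v\<close>.\<close>
    fix S assume *: "\<forall>v \<in> verts G. chromatic_number (del_vert v) \<le> 3" and S: "S \<subset> verts G"
    then obtain v where "v \<in> verts G" "S \<subseteq> verts G - {v}" by blast
    then show "chromatic_number (G \<restriction> S) \<le> 3" using * del by (meson le_trans)
  qed
  also have "\<dots> \<longleftrightarrow> vertex_critical 4 G"
  proof -
    \<comment> \<open>Criticality asks for \<chi> exactly 4, while so far only \<chi> > 3 is known;
      the upper bound comes from restoring one deleted vertex.\<close>
    have "chromatic_number G \<le> 4"
      if gt: "3 < chromatic_number G" and v: "\<forall>v \<in> verts G. chromatic_number (del_vert v) \<le> 3"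
    proof -
      \<comment> \<open>For an empty vertex set the condition on deletions is vacuous, so a vertex
        to delete must be obtained from \<chi> > 3.\<close>
      have "verts G \<noteq> {}"
      proof
        assume "verts G = {}"
        then have "proper_coloring G 3 (\<lambda>_. 0)"
          using adj_in_verts by (auto simp: proper_coloring_def)
        then show False using gt chromatic_number_le_iff[of 3] by auto
      qed
      then obtain v where v_in: "v \<in> verts G" by blast
      then have "graph (G \<restriction> {v})" by (intro graph_induce) auto
      moreover have "proper_coloring (G \<restriction> {v}) 1 (\<lambda>_. 0)"
        using adj_not_same by (auto simp: proper_coloring_def adj_induce_iff)
      ultimately have "chromatic_number (G \<restriction> {v}) \<le> 1"
        using graph.chromatic_number_le_iff by blast
      \<comment> \<open>Splitting off \<open>v\<close> bounds \<chi> by 3 + 1.\<close>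
      moreover have "(verts G - {v}) \<union> {v} = verts G" using v_in by auto
      note chromatic_number_union_le[OF this]
      moreover have "chromatic_number (del_vert v) \<le> 3" using v v_in by blast
      ultimately show ?thesis by (simp add: del_vert_eq_induce)
    qed
    then show ?thesis unfolding vertex_critical_def by force
  qed
  finally show ?thesis .
qed

end
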